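(* There is an effective procedure assigning to every ordered tuple $\mathcal{V}=(v_1,\dots,v_m)$ of vectors in $\mathbb{Z}^{2n}$ that generates $\mathbb{Z}^{2n}$ as a $\mathbb{Z}$-module a symplectic basis $\mathrm{SympBas}(\mathcal{V})$ of $\mathbb{Z}^{2n}$ such that for every $P\in\mathrm{Sp}_{2n}(\mathbb{Z})$ we have $\mathrm{SympBas}(\mathcal{V}P)=\mathrm{SympBas}(\mathcal{V})P$.
   Context: Vectors in $\mathbb{Z}^{2n}$ are written as row vectors, and for a tuple $\mathcal{V}=(v_1,\dots,v_m)$ and a matrix $P$, $\mathcal{V}P=(v_1P,\dots,v_mP)$; similarly a basis $(w_1,\dots,w_{2n})$ is mapped to $(w_1P,\dots,w_{2n}P)$. Let $J_n=\begin{pmatrix}0&I_n\\-I_n&0\end{pmatrix}$, $\omega(x,y)=xJ_ny^{\mathsf{T}}$ the standard alternating pairing, and $\mathrm{Sp}_{2n}(\mathbb{Z})=\{Q\in\mathrm{GL}_{2n}(\mathbb{Z}):Q^{\mathsf{T}}J_nQ=J_n\}$. A symplectic basis of $\mathbb{Z}^{2n}$ is a $\mathbb{Z}$-basis $e_1,\dots,e_n,f_1,\dots,f_n$ with $\omega(e_i,f_j)=\delta_{ij}$ and $\omega(e_i,e_j)=\omega(f_i,f_j)=0$ for all $i,j$. *)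

theory Defs
  imports
    "Jordan_Normal_Form.VS_Connect"
    "HOL-Library.Nat_Bijection"
begin

subsection \<open>Effective procedures\<close>

text \<open>Partial recursive functions of arbitrary arity: \<open>rec_eval p xs y\<close> says that the program
  \<open>p\<close>, run on the argument list \<open>xs\<close>, halts with value \<open>y\<close>. Ill-formed applications, such as a
  projection to a non-existent argument, have no value.\<close>

datatype recfn =
    Zero
  | Succ
  | Proj nat
  | Comp recfn "recfn list"
  | PrimRec recfn recfn
  | Mu recfn

inductive rec_eval :: "recfn \<Rightarrow> nat list \<Rightarrow> nat \<Rightarrow> bool" where
  Zero: "rec_eval Zero xs 0"
| Succ: "rec_eval Succ [x] (Suc x)"
| Proj: "i < length xs \<Longrightarrow> rec_eval (Proj i) xs (xs ! i)"
| Comp: "list_all2 (\<lambda>g y. rec_eval g xs y) gs ys \<Longrightarrow> rec_eval f ys z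
    \<Longrightarrow> rec_eval (Comp f gs) xs z"
| PrimRec_0: "rec_eval f xs y \<Longrightarrow> rec_eval (PrimRec f g) (0 # xs) y"
| PrimRec_Suc: "rec_eval (PrimRec f g) (k # xs) r \<Longrightarrow> rec_eval g (k # r # xs) y
    \<Longrightarrow> rec_eval (PrimRec f g) (Suc k # xs) y"
| Mu: "rec_eval f (k # xs) 0 \<Longrightarrow> \<forall>i<k. \<exists>y. rec_eval f (i # xs) (Suc y)
    \<Longrightarrow> rec_eval (Mu f) xs k"

lemma rec_eval_deterministic:
  "rec_eval p xs y \<Longrightarrow> rec_eval p xs z \<Longrightarrow> y = z"
proof (induction arbitrary: z rule: rec_eval.induct)
  case (Zero xs)
  then show ?case by (auto elim: rec_eval.cases)
next
  case (Succ x)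
  then show ?case by (auto elim: rec_eval.cases)
next
  case (Proj i xs)
  from Proj.prems show ?case by (cases rule: rec_eval.cases) auto
next
  case (Comp xs gs ys f y)
  from Comp.prems obtain ys' where ys': "list_all2 (\<lambda>g y. rec_eval g xs y) gs ys'"
    and z: "rec_eval f ys' z"
    by (cases rule: rec_eval.cases) auto
  have "ys = ys'"
    using Comp.IH(1) ys' by (auto simp: list_all2_conv_all_nth intro!: nth_equalityI)
  with Comp.IH(2) z show ?case by simp
next
  case (PrimRec_0 f xs y g)
  from PrimRec_0.prems PrimRec_0.IH show ?case by (cases rule: rec_eval.cases) auto
next
  case (PrimRec_Suc f g k xs r y)
  from PrimRec_Suc.prems obtain r' where "rec_eval (PrimRec f g) (k # xs) r'"
    and "rec_eval g (k # r' # xs) z"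
    by (cases rule: rec_eval.cases) auto
  with PrimRec_Suc.IH show ?case by blast
next
  case (Mu f k xs)
  from Mu.prems obtain z0: "rec_eval f (z # xs) 0"
    and z1: "\<forall>i<z. \<exists>y. rec_eval f (i # xs) (Suc y)"
    by (cases rule: rec_eval.cases) auto
  have "\<not> z < k" using Mu.IH(2) z0 by blast
  moreover have "\<not> k < z" using Mu.IH(1) z1 by blast
  ultimately show ?case by simp
qed

text \<open>\<open>f\<close> is effective on \<open>A\<close>, relative to numberings \<open>enc\<^sub>1\<close> of its arguments and \<open>enc\<^sub>2\<close> of its
  values, if one program computes it, and in particular halts, on all of \<open>A\<close>.\<close>

definition effective_on :: "('a \<Rightarrow> nat) \<Rightarrow> ('b \<Rightarrow> nat) \<Rightarrow> 'a set \<Rightarrow> ('a \<Rightarrow> 'b) \<Rightarrow> bool" where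
  "effective_on enc\<^sub>1 enc\<^sub>2 A f \<longleftrightarrow> (\<exists>p. \<forall>x\<in>A. rec_eval p [enc\<^sub>1 x] (enc\<^sub>2 (f x)))"

definition encode_tuple :: "int vec list \<Rightarrow> nat" where
  "encode_tuple vs = list_encode (map (\<lambda>v. list_encode (map int_encode (list_of_vec v))) vs)"

lemma inj_encode_tuple: "inj encode_tuple"
proof (rule injI)
  fix vs ws assume "encode_tuple vs = encode_tuple ws"
  moreover have "inj (\<lambda>v. list_encode (map int_encode (list_of_vec v)))"
    by (rule injI) (metis inj_int_encode inj_map_eq_map list_encode_eq vec_list)
  ultimately show "vs = ws"
    by (simp add: encode_tuple_def list_encode_eq inj_map_eq_map)
qed


subsection \<open>Symplectic bases\<close>

text \<open>The row vector \<open>v P\<close>, computed as the transpose of \<open>P\<^sup>T v\<^sup>T\<close>.\<close>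

definition row_mult_mat :: "int vec \<Rightarrow> int mat \<Rightarrow> int vec" where
  "row_mult_mat v P = transpose_mat P *\<^sub>v v"

definition tuple_mult_mat :: "int vec list \<Rightarrow> int mat \<Rightarrow> int vec list" where
  "tuple_mult_mat vs P = map (\<lambda>v. row_mult_mat v P) vs"

definition J_mat :: "nat \<Rightarrow> int mat" where
  "J_mat n = four_block_mat (0\<^sub>m n n) (1\<^sub>m n) (- 1\<^sub>m n) (0\<^sub>m n n)"

definition omega :: "nat \<Rightarrow> int vec \<Rightarrow> int vec \<Rightarrow> int" where
  "omega n x y = x \<bullet> (J_mat n *\<^sub>v y)"

definition Sp :: "nat \<Rightarrow> int mat set" where
  "Sp n = {Q \<in> carrier_mat (2 * n) (2 * n).
     invertible_mat Q \<and> transpose_mat Q * J_mat n * Q = J_mat n}"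

definition generates :: "nat \<Rightarrow> int vec list \<Rightarrow> bool" where
  "generates d vs \<longleftrightarrow> set vs \<subseteq> carrier_vec d \<and>
     LinearCombinations.module.span class_ring (module_vec TYPE(int) d) (set vs) = carrier_vec d"

definition Z_basis :: "nat \<Rightarrow> int vec list \<Rightarrow> bool" where
  "Z_basis d ws \<longleftrightarrow> generates d ws \<and> distinct ws \<and>
     \<not> LinearCombinations.module.lin_dep class_ring (module_vec TYPE(int) d) (set ws)"

text \<open>A symplectic basis is listed as \<open>e\<^sub>1, \<dots>, e\<^sub>n, f\<^sub>1, \<dots>, f\<^sub>n\<close>.\<close>

definition symplectic_basis :: "nat \<Rightarrow> int vec list \<Rightarrow> bool" where
  "symplectic_basis n ws \<longleftrightarrow> length ws = 2 * n \<and> Z_basis (2 * n) ws \<and>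
     (\<forall>i<n. \<forall>j<n.
        omega n (ws ! i) (ws ! (n + j)) = (if i = j then 1 else 0) \<and>
        omega n (ws ! i) (ws ! j) = 0 \<and>
        omega n (ws ! (n + i)) (ws ! (n + j)) = 0)"

end

theory Submission
  imports Defs
begin

text \<open>Search for the first tuple \<open>C\<close> of integral coefficient vectors such that the vectors
  \<open>C \<cdot> V\<close> satisfy the symplectic relations. One exists because \<open>V\<close> generates the lattice, so that
  even the standard basis is a combination of \<open>V\<close>; and any \<open>2n\<close> integral vectors satisfying the
  relations form a basis, as their matrix \<open>W\<close> with \<open>W J W\<^sup>T = J\<close> is invertible over the integers.
  Whether \<open>C\<close> passes the test depends only on the values \<open>\<omega>(v\<^sub>i, v\<^sub>j)\<close>, which \<open>P \<in> Sp n\<close>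
  preserves. Hence \<open>V\<close> and \<open>V P\<close> lead to the same \<open>C\<close>, and \<open>C \<cdot> (V P) = (C \<cdot> V) P\<close>.\<close>


section \<open>Computable functions between encoded types\<close>

text \<open>A bijection rather than an injection: every number is the code of some value, so an
  unbounded search over numbers is a search over all values of the type.\<close>

class encodable =
  fixes enc :: "'a \<Rightarrow> nat"
  assumes bij_enc: "bij enc"

lemma enc_eq_iff [simp]: "enc x = enc y \<longleftrightarrow> x = y"
  by (rule inj_eq) (rule bij_is_inj[OF bij_enc])

definition dec :: "nat \<Rightarrow> 'a :: encodable" where
  "dec = inv_into UNIV enc"

lemma dec_enc [simp]: "dec (enc x) = x"
  unfolding dec_def by (rule inv_f_f) (rule bij_is_inj[OF bij_enc])

lemma enc_dec [simp]: "enc (dec k) = k"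
  unfolding dec_def by (rule surj_f_inv_f) (rule bij_is_surj[OF bij_enc])

instantiation nat :: encodable
begin
definition [simp]: "enc (n :: nat) = n"
instance by standard (simp add: bij_def inj_def)
end

instantiation int :: encodable
begin
definition [simp]: "enc = int_encode"
instance by standard (simp add: bij_int_encode)
end

instantiation prod :: (encodable, encodable) encodable
begin
definition "enc p = prod_encode (enc (fst p), enc (snd p))"
instance
proof
  show "bij (enc :: 'a \<times> 'b \<Rightarrow> nat)"
  proof (rule bijI)
    show "inj (enc :: 'a \<times> 'b \<Rightarrow> nat)"
      by (rule injI) (simp add: enc_prod_def prod_eq_iff)
    have "enc (dec (fst (prod_decode k)) :: 'a, dec (snd (prod_decode k)) :: 'b) = k" for k
      by (simp add: enc_prod_def)
    then show "surj (enc :: 'a \<times> 'b \<Rightarrow> nat)" by (rule surjI)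
  qed
qed
end

instantiation list :: (encodable) encodable
begin
definition "enc xs = list_encode (map enc xs)"
instance
proof
  show "bij (enc :: 'a list \<Rightarrow> nat)"
  proof (rule bijI)
    show "inj (enc :: 'a list \<Rightarrow> nat)"
      using inj_map_eq_map[OF bij_is_inj[OF bij_enc]]
      by (auto simp: inj_def enc_list_def list_encode_eq)
    have "enc (map (dec :: nat \<Rightarrow> 'a) (list_decode k)) = k" for k
      by (simp add: enc_list_def comp_def)
    then show "surj (enc :: 'a list \<Rightarrow> nat)" by (rule surjI)
  qed
qed
end

text \<open>Reduces consing and its inverse to pairing and the successor, for which there are
  explicit programs.\<close>

lemma enc_Cons: "enc (x # xs) = Suc (enc (x, xs))"
  by (simp add: enc_list_def enc_prod_def)

text \<open>Totality is built in, so closure rules need no domain conditions; partiality enters only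
  with the final search.\<close>

definition computable :: "('a :: encodable \<Rightarrow> 'b :: encodable) \<Rightarrow> bool" where
  "computable f \<longleftrightarrow> effective_on enc enc UNIV f"

definition decidable :: "('a :: encodable \<Rightarrow> bool) \<Rightarrow> bool" where
  "decidable P \<longleftrightarrow> computable (\<lambda>x. if P x then 1 else 0 :: nat)"

lemma computableI: "(\<And>x. rec_eval p [enc x] (enc (f x))) \<Longrightarrow> computable f"
  by (auto simp: computable_def effective_on_def)

lemma computableE:
  assumes "computable f"
  obtains p where "\<And>x. rec_eval p [enc x] (enc (f x))"
  using assms by (auto simp: computable_def effective_on_def)


subsection \<open>Programs for the pairing function\<close>

named_theorems rec_eval_intros

text \<open>Instances at fixed positions let programs be run by resolution alone, without side
  conditions on list lengths.\<close>

lemma rec_eval_Proj [rec_eval_intros]: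
  "rec_eval (Proj 0) (x # xs) x"
  "rec_eval (Proj 1) (x # y # xs) y"
  "rec_eval (Proj (Suc 0)) (x # y # xs) y"
  "rec_eval (Proj 2) (x # y # z # xs) z"
  using rec_eval.Proj[of 0 "x # xs"] rec_eval.Proj[of 1 "x # y # xs"]
    rec_eval.Proj[of 2 "x # y # z # xs"] by simp_all

lemma rec_eval_Comp1 [rec_eval_intros]: "rec_eval g xs y \<Longrightarrow> rec_eval f [y] z \<Longrightarrow> rec_eval (Comp f [g]) xs z"
  by (rule rec_eval.Comp[of _ _ "[y]"]) auto

lemma rec_eval_Comp2 [rec_eval_intros]:
  "rec_eval g xs y \<Longrightarrow> rec_eval h xs z \<Longrightarrow> rec_eval f [y, z] w \<Longrightarrow> rec_eval (Comp f [g, h]) xs w"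
  by (rule rec_eval.Comp[of _ _ "[y, z]"]) auto

lemma rec_eval_Comp3:
  "rec_eval g xs y \<Longrightarrow> rec_eval h xs z \<Longrightarrow> rec_eval i xs w \<Longrightarrow> rec_eval f [y, z, w] v
    \<Longrightarrow> rec_eval (Comp f [g, h, i]) xs v"
  by (rule rec_eval.Comp[of _ _ "[y, z, w]"]) auto

declare rec_eval.Zero [rec_eval_intros] rec_eval.Succ [rec_eval_intros]

text \<open>The step of \<open>PrimRec\<close> receives the counter, the previous value and then the
  parameters, so \<open>Proj 1\<close> is the previous value. \<open>minus_prog\<close> recurses on
  the subtrahend, which therefore comes first.\<close>

definition "add_prog = PrimRec (Proj 0) (Comp Succ [Proj 1])"
definition "pred_prog = PrimRec Zero (Proj 0)"
definition "minus_prog = PrimRec (Proj 0) (Comp pred_prog [Proj 1])"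
definition "triangle_prog = PrimRec Zero (Comp add_prog [Proj 1, Comp Succ [Proj 0]])"
definition "pair_prog = Comp add_prog [Comp triangle_prog [add_prog], Proj 0]"
text \<open>Searches for \<open>m + n\<close>, given \<open>prod_encode (m, n) = triangle (m + n) + m\<close>.\<close>

definition "diag_prog =
  Mu (Comp minus_prog [Comp triangle_prog [Comp Succ [Proj 0]], Comp Succ [Proj 1]])"
definition "fst_prog = Comp minus_prog [Comp triangle_prog [diag_prog], Proj 0]"
definition "snd_prog = Comp minus_prog [fst_prog, diag_prog]"
text \<open>Recursion used as a case split: the base case sees \<open>[x, y]\<close> and picks
  \<open>y\<close>; the step sees \<open>[k, r, x, y]\<close> and picks \<open>x\<close>, ignoring
  the previous value \<open>r\<close>.\<close>

definition "if_prog = PrimRec (Proj 1) (Proj 2)"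

lemma rec_eval_add [rec_eval_intros]: "rec_eval add_prog [m, n] (m + n)"
proof (induction m)
  case 0
  show ?case unfolding add_prog_def by (rule rec_eval.PrimRec_0, simp, rule rec_eval_intros)
next
  case (Suc m)
  show ?case unfolding add_prog_def
    by (rule rec_eval.PrimRec_Suc[OF Suc.IH[unfolded add_prog_def]]) (simp, (rule rec_eval_intros)+)
qed

lemma rec_eval_pred [rec_eval_intros]: "rec_eval pred_prog [m] (m - 1)"
proof (induction m)
  case 0
  show ?case unfolding pred_prog_def by (rule rec_eval.PrimRec_0, simp, rule rec_eval_intros)
next
  case (Suc m)
  show ?case unfolding pred_prog_def
    by (rule rec_eval.PrimRec_Suc[OF Suc.IH[unfolded pred_prog_def]]) (simp, rule rec_eval_intros)
qed

lemma rec_eval_minus [rec_eval_intros]: "rec_eval minus_prog [m, n] (n - m)"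
proof (induction m)
  case 0
  show ?case unfolding minus_prog_def by (rule rec_eval.PrimRec_0, simp, rule rec_eval_intros)
next
  case (Suc m)
  have "rec_eval (Comp pred_prog [Proj 1]) [m, n - m, n] (n - Suc m)"
    unfolding diff_Suc_eq_diff_pred[of n m] diff_commute[of n 1 m] by (rule rec_eval_intros)+
  then show ?case unfolding minus_prog_def
    by (rule rec_eval.PrimRec_Suc[OF Suc.IH[unfolded minus_prog_def]])
qed

lemma rec_eval_triangle [rec_eval_intros]: "rec_eval triangle_prog [m] (triangle m)"
proof (induction m)
  case 0
  show ?case unfolding triangle_prog_def by (rule rec_eval.PrimRec_0, simp, rule rec_eval_intros)
next
  case (Suc m)
  have "rec_eval (Comp add_prog [Proj 1, Comp Succ [Proj 0]]) [m, triangle m] (triangle (Suc m))"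
    unfolding triangle_Suc by (rule rec_eval_intros)+
  then show ?case unfolding triangle_prog_def
    by (rule rec_eval.PrimRec_Suc[OF Suc.IH[unfolded triangle_prog_def]])
qed

lemma rec_eval_pair [rec_eval_intros]: "rec_eval pair_prog [m, n] (prod_encode (m, n))"
  unfolding pair_prog_def prod_encode_def prod.case
  by (rule rec_eval_intros)+

lemma triangle_mono: "m \<le> n \<Longrightarrow> triangle m \<le> triangle n"
  by (rule lift_Suc_mono_le) auto

text \<open>For \<open>z = triangle (m + n) + m\<close> one has
  \<open>triangle (m + n) \<le> z < triangle (Suc (m + n))\<close>, so \<open>m + n\<close> is the
  least \<open>k\<close> with \<open>z < triangle (Suc k)\<close>. This inequality says exactly that
  the truncated difference \<open>Suc z - triangle (Suc k)\<close> vanishes.\<close>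

lemma rec_eval_diag [rec_eval_intros]: "rec_eval diag_prog [prod_encode (m, n)] (m + n)"
proof -
  let ?z = "prod_encode (m, n)"
  have step: "rec_eval (Comp minus_prog [Comp triangle_prog [Comp Succ [Proj 0]], Comp Succ [Proj 1]])
      [k, ?z] (Suc ?z - triangle (Suc k))" for k
    by (rule rec_eval_intros)+
  show ?thesis unfolding diag_prog_def
  proof (rule rec_eval.Mu)
    show "rec_eval (Comp minus_prog [Comp triangle_prog [Comp Succ [Proj 0]], Comp Succ [Proj 1]])
        [m + n, ?z] 0"
      using step[of "m + n"] by (simp add: prod_encode_def)
    have "\<exists>y. Suc ?z - triangle (Suc i) = Suc y" if "i < m + n" for i
      using triangle_mono[of "Suc i" "m + n"] that
      by (intro exI[of _ "?z - triangle (Suc i)"]) (simp add: prod_encode_def)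
    then show "\<forall>i<m + n. \<exists>y. rec_eval (Comp minus_prog [Comp triangle_prog [Comp Succ [Proj 0]],
        Comp Succ [Proj 1]]) [i, ?z] (Suc y)"
      using step by metis
  qed
qed

lemma rec_eval_fst [rec_eval_intros]: "rec_eval fst_prog [prod_encode (m, n)] m"
proof -
  have "rec_eval fst_prog [prod_encode (m, n)] (prod_encode (m, n) - triangle (m + n))"
    unfolding fst_prog_def
    by (rule rec_eval_intros)+
  then show ?thesis by (simp add: prod_encode_def)
qed

lemma rec_eval_snd [rec_eval_intros]: "rec_eval snd_prog [prod_encode (m, n)] n"
proof -
  have "rec_eval snd_prog [prod_encode (m, n)] (m + n - m)"
    unfolding snd_prog_def
    by (rule rec_eval_intros)+
  then show ?thesis by simp
qed

lemma rec_eval_if: "rec_eval if_prog [k, x, y] (if k = 0 then y else x)"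
proof (induction k)
  case 0
  show ?case unfolding if_prog_def by (rule rec_eval.PrimRec_0, simp, rule rec_eval_intros)
next
  case (Suc m)
  show ?case unfolding if_prog_def
    by (rule rec_eval.PrimRec_Suc[OF Suc.IH[unfolded if_prog_def]])
      (simp only: nat.distinct if_False, rule rec_eval_intros)
qed


subsection \<open>Closure properties\<close>

named_theorems computable_intros

lemma computable_compose:
  assumes "computable g" and "computable f"
  shows "computable (\<lambda>x. g (f x))"
proof -
  obtain p q where "\<And>x. rec_eval p [enc x] (enc (g x))" "\<And>x. rec_eval q [enc x] (enc (f x))"
    using assms by (auto elim!: computableE)
  then show ?thesis
    by (auto intro!: computableI[of "Comp p [q]"] rec_eval_Comp1)
qed

lemma computable_id [computable_intros]: "computable (\<lambda>x. x)"
  by (rule computableI[of "Proj 0"]) (rule rec_eval_intros)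

lemma computable_const [computable_intros]: "computable (\<lambda>x. c)"
proof -
  have "\<exists>p. \<forall>xs. rec_eval p xs k" for k
    by (induction k) (metis rec_eval.Zero, metis rec_eval_Comp1 rec_eval.Succ)
  then show ?thesis by (metis computableI)
qed

text \<open>As only codes matter, conversions between types that preserve the code are free.\<close>

lemma computable_cast:
  assumes "computable f" and "\<And>x. enc (g x) = enc (f x)"
  shows "computable g"
  using assms by (simp add: computable_def effective_on_def)

lemma computable_enc [computable_intros]: "computable f \<Longrightarrow> computable (\<lambda>x. enc (f x))"
  by (erule computable_cast) simp

lemma computable_Suc [computable_intros]:
  assumes "computable f" shows "computable (\<lambda>x. Suc (f x))"
proof -
  have "computable Suc"
    by (rule computableI[of Succ]) (simp add: rec_eval.Succ)
  then show ?thesis using assms by (rule computable_compose)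
qed

lemma computable_binary:
  assumes op: "\<And>a b. rec_eval q [enc a, enc b] (enc (h a b))"
    and "computable f" and "computable g"
  shows "computable (\<lambda>x. h (f x) (g x))"
proof -
  obtain p1 p2 where "\<And>x. rec_eval p1 [enc x] (enc (f x))" "\<And>x. rec_eval p2 [enc x] (enc (g x))"
    using assms by (auto elim!: computableE)
  then have "rec_eval (Comp q [p1, p2]) [enc x] (enc (h (f x) (g x)))" for x
    using op by (rule rec_eval_Comp2)
  then show ?thesis by (rule computableI)
qed

lemma computable_add [computable_intros]:
  "computable f \<Longrightarrow> computable g \<Longrightarrow> computable (\<lambda>x. f x + g x :: nat)"
  by (rule computable_binary[of add_prog]) (simp add: rec_eval_add)

lemma computable_minus [computable_intros]:
  "computable f \<Longrightarrow> computable g \<Longrightarrow> computable (\<lambda>x. f x - g x :: nat)"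
  by (rule computable_binary[of minus_prog "\<lambda>a b. b - a"]) (simp add: rec_eval_minus)

lemma computable_Pair [computable_intros]:
  "computable f \<Longrightarrow> computable g \<Longrightarrow> computable (\<lambda>x. (f x, g x))"
  by (rule computable_binary[of pair_prog]) (simp add: rec_eval_pair enc_prod_def)

lemma computable_fst [computable_intros]:
  assumes "computable f" shows "computable (\<lambda>x. fst (f x))"
proof -
  have "computable (fst :: 'b \<times> 'c \<Rightarrow> 'b)"
    by (rule computableI[of fst_prog]) (simp add: rec_eval_fst enc_prod_def)
  then show ?thesis using assms by (rule computable_compose)
qed

lemma computable_snd [computable_intros]:
  assumes "computable f" shows "computable (\<lambda>x. snd (f x))"
proof -
  have "computable (snd :: 'b \<times> 'c \<Rightarrow> 'c)"
    by (rule computableI[of snd_prog]) (simp add: rec_eval_snd enc_prod_def)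
  then show ?thesis using assms by (rule computable_compose)
qed

text \<open>The program evaluates both branches before choosing, which is harmless as both are
  total.\<close>

lemma computable_if [computable_intros]:
  assumes "decidable P" and "computable f" and "computable g"
  shows "computable (\<lambda>x. if P x then f x else g x)"
proof -
  obtain p q r where p: "\<And>x. rec_eval p [enc x] (if P x then 1 else 0)"
    and q: "\<And>x. rec_eval q [enc x] (enc (f x))" and r: "\<And>x. rec_eval r [enc x] (enc (g x))"
    using assms by (auto simp: decidable_def computable_def effective_on_def)
  have "rec_eval (Comp if_prog [p, q, r]) [enc x] (enc (if P x then f x else g x))" for x
    using rec_eval_Comp3[OF p q r rec_eval_if, of x] by (auto split: if_splits)
  then show ?thesis by (rule computableI)
qed

lemma decidable_not [computable_intros]:
  assumes "decidable P" shows "decidable (\<lambda>x. \<not> P x)"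
proof -
  have "computable (\<lambda>x. if P x then 0 else 1 :: nat)"
    by (intro computable_intros assms)
  then show ?thesis unfolding decidable_def by (rule computable_cast) simp
qed

lemma decidable_conj [computable_intros]:
  assumes "decidable P" and "decidable Q"
  shows "decidable (\<lambda>x. P x \<and> Q x)"
proof -
  have "computable (\<lambda>x. if P x then if Q x then 1 else 0 else 0 :: nat)"
    by (intro computable_intros assms)
  then show ?thesis unfolding decidable_def by (rule computable_cast) simp
qed

lemma decidable_less [computable_intros]:
  assumes "computable f" and "computable g"
  shows "decidable (\<lambda>x. (f x :: nat) < g x)"
proof -
  \<comment> \<open>With truncated subtraction this is the sign of \<open>g x - f x\<close>, hence
    the 0-1 indicator of the inequality.\<close>
  have "computable (\<lambda>x. 1 - (1 - (g x - f x)))"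
    by (intro computable_intros assms)
  then show ?thesis unfolding decidable_def by (rule computable_cast) simp
qed

lemma decidable_eq [computable_intros]:
  fixes f g :: "'a :: encodable \<Rightarrow> 'b :: encodable"
  assumes "computable f" and "computable g"
  shows "decidable (\<lambda>x. f x = g x)"
proof -
  have "decidable (\<lambda>x. \<not> enc (f x) < enc (g x) \<and> \<not> enc (g x) < enc (f x))"
    by (intro computable_intros assms)
  moreover have "\<not> enc a < enc b \<and> \<not> enc b < enc a \<longleftrightarrow> a = b" for a b :: 'b
    by (metis enc_eq_iff linorder_neq_iff)
  ultimately show ?thesis by simp
qed

text \<open>The source of all later loops: arithmetic, list operations and sums are written as
  iterates of a step on a state. The step may depend on the input \<open>x\<close>, which the
  program passes along paired with the state.\<close>

lemma computable_funpow [computable_intros]: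
  fixes h :: "'a :: encodable \<Rightarrow> 'b :: encodable \<Rightarrow> 'b"
  assumes "computable (\<lambda>p. h (fst p) (snd p))" and "computable n" and "computable s"
  shows "computable (\<lambda>x. (h x ^^ n x) (s x))"
proof -
  obtain p where p: "\<And>x. rec_eval p [enc x] (enc (h (fst x) (snd x)))"
    using assms(1) by (rule computableE) (rule that)
  obtain q where q: "\<And>x. rec_eval q [enc x] (enc (n x))"
    using assms(2) by (rule computableE) (rule that)
  obtain r where r: "\<And>x. rec_eval r [enc x] (enc (s x))"
    using assms(3) by (rule computableE) (rule that)
  let ?loop = "PrimRec r (Comp p [Comp pair_prog [Proj 2, Proj 1]])"
  have loop: "rec_eval ?loop [k, enc x] (enc ((h x ^^ k) (s x)))" for k x
  proof (induction k)
    case 0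
    show ?case using r by (auto intro: rec_eval.PrimRec_0)
  next
    case (Suc k)
    let ?s = "(h x ^^ k) (s x)"
    have "rec_eval (Comp pair_prog [Proj 2, Proj 1]) [k, enc ?s, enc x] (enc (x, ?s))"
      unfolding enc_prod_def fst_conv snd_conv by (rule rec_eval_intros)+
    from rec_eval_Comp1[OF this p]
    have "rec_eval (Comp p [Comp pair_prog [Proj 2, Proj 1]]) [k, enc ?s, enc x]
        (enc ((h x ^^ Suc k) (s x)))" by simp
    with Suc.IH show ?case by (rule rec_eval.PrimRec_Suc)
  qed
  show ?thesis
    by (rule computableI[of "Comp ?loop [q, Proj 0]"], rule rec_eval_Comp2[OF q[unfolded enc_nat_def] _ loop])
      (rule rec_eval_intros)
qed


subsection \<open>Integers\<close>

text \<open>From \<open>n\<close> to \<open>Suc n\<close> the second component moves to the first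
  place, and the new second one is \<open>Suc (Suc n) div 2 = Suc (n div 2)\<close>.\<close>

lemma half_funpow: "((\<lambda>p. (snd p, Suc (fst p))) ^^ n) (0, 0) = (n div 2, Suc n div 2)"
  by (induction n) auto

lemma computable_half [computable_intros]:
  assumes "computable f" shows "computable (\<lambda>x. f x div 2 :: nat)"
proof -
  have "computable (\<lambda>n. fst (((\<lambda>p :: nat \<times> nat. (snd p, Suc (fst p))) ^^ n) (0, 0)))"
    by (intro computable_intros)
  then have "computable (\<lambda>n :: nat. n div 2)" unfolding half_funpow fst_conv .
  then show ?thesis using assms by (rule computable_compose)
qed

lemma decidable_even [computable_intros]:
  assumes "computable f" shows "decidable (\<lambda>x. even (f x :: nat))"
proof -
  have "decidable (\<lambda>x. f x = f x div 2 + f x div 2)"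
    by (intro computable_intros assms)
  moreover have "n = n div 2 + n div 2 \<longleftrightarrow> even n" for n :: nat by presburger
  ultimately show ?thesis by simp
qed

text \<open>Nonnegative integers have even codes and negative ones odd codes, so sign and absolute
  value are read off by parity and halving.\<close>

lemma int_encode_eq_if: "int_encode i = (if 0 \<le> i then 2 * nat i else 2 * nat (- i) - 1)"
  by (auto simp: int_encode_def sum_encode_def)

lemma computable_nat [computable_intros]:
  assumes "computable f" shows "computable (\<lambda>x. nat (f x))"
proof -
  have "computable (\<lambda>x. if even (enc (f x)) then enc (f x) div 2 else 0)"
    by (intro computable_intros assms)
  then show ?thesis
    by (rule computable_cast) (auto simp: int_encode_eq_if)
qed

lemma computable_nat_uminus [computable_intros]:
  assumes "computable f" shows "computable (\<lambda>x. nat (- f x))"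
proof -
  have "computable (\<lambda>x. if even (enc (f x)) then 0 else Suc (enc (f x)) div 2)"
    by (intro computable_intros assms)
  then show ?thesis
    by (rule computable_cast) (auto simp: int_encode_eq_if)
qed

lemma computable_int_succ [computable_intros]:
  assumes "computable f" shows "computable (\<lambda>x. f x + 1 :: int)"
proof -
  \<comment> \<open>Even codes move up by two and odd codes down by two, except that -1, with code
    1, goes to 0, with code 0. The predecessor below is the mirror image.\<close>
  have "computable (\<lambda>x. if even (enc (f x)) then enc (f x) + 2
      else if enc (f x) = 1 then 0 else enc (f x) - 2)"
    by (intro computable_intros assms)
  then show ?thesis
    by (rule computable_cast) (auto simp: int_encode_eq_if nat_add_distrib)
qed

lemma computable_int_pred [computable_intros]:
  assumes "computable f" shows "computable (\<lambda>x. f x - 1 :: int)"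
proof -
  have "computable (\<lambda>x. if even (enc (f x)) then if enc (f x) = 0 then 1 else enc (f x) - 2
      else enc (f x) + 2)"
    by (intro computable_intros assms)
  then show ?thesis
    by (rule computable_cast) (auto simp: int_encode_eq_if nat_add_distrib)
qed

lemma funpow_add_const: "((\<lambda>s. s + c) ^^ k) s = s + of_nat k * (c :: int)"
  by (induction k) (auto simp: algebra_simps)

lemma funpow_minus_const: "((\<lambda>s. s - c) ^^ k) s = s - of_nat k * (c :: int)"
  by (induction k) (auto simp: algebra_simps)

lemma computable_int_add [computable_intros]:
  assumes "computable f" and "computable g"
  shows "computable (\<lambda>x. f x + g x :: int)"
proof -
  \<comment> \<open>An integer \<open>b\<close> is \<open>nat b - nat (- b)\<close> with one term
    zero, so running both loops avoids a case split on the sign. Subtraction and multiplication do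
    the same.\<close>
  have "computable (\<lambda>x. ((\<lambda>s. s - 1) ^^ nat (- g x)) (((\<lambda>s. s + 1) ^^ nat (g x)) (f x)))"
    by (intro computable_intros assms)
  then show ?thesis
    by (rule computable_cast) (simp add: funpow_add_const funpow_minus_const)
qed

lemma computable_int_minus [computable_intros]:
  assumes "computable f" and "computable g"
  shows "computable (\<lambda>x. f x - g x :: int)"
proof -
  have "computable (\<lambda>x. ((\<lambda>s. s + 1) ^^ nat (- g x)) (((\<lambda>s. s - 1) ^^ nat (g x)) (f x)))"
    by (intro computable_intros assms)
  then show ?thesis
    by (rule computable_cast) (simp add: funpow_add_const funpow_minus_const)
qed

lemma computable_int_mult [computable_intros]:
  assumes "computable f" and "computable g"
  shows "computable (\<lambda>x. f x * g x :: int)"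
proof -
  have "computable (\<lambda>x. ((\<lambda>s. s - f x) ^^ nat (- g x)) (((\<lambda>s. s + f x) ^^ nat (g x)) 0))"
    by (intro computable_intros assms computable_compose[OF assms(1)])
  moreover have "((\<lambda>s. s - f x) ^^ nat (- g x)) (((\<lambda>s. s + f x) ^^ nat (g x)) 0) = f x * g x" for x
    by (cases "0 \<le> g x") (simp_all add: funpow_add_const funpow_minus_const)
  ultimately show ?thesis by simp
qed


subsection \<open>Lists\<close>

lemma computable_Cons [computable_intros]:
  assumes "computable f" and "computable g"
  shows "computable (\<lambda>x. f x # g x)"
proof -
  have "computable (\<lambda>x. Suc (enc (f x, g x)))"
    by (intro computable_intros assms)
  then show ?thesis by (rule computable_cast) (simp add: enc_Cons)
qed

text \<open>The junk value \<open>hd []\<close> is some fixed constant, so it does not obstruct computability.\<close>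

lemma enc_uncons: "enc (hd xs, tl xs) = enc xs - 1" if "xs \<noteq> []"
  using that by (cases xs) (simp_all add: enc_Cons)

lemma computable_uncons:
  fixes f :: "'a :: encodable \<Rightarrow> 'b :: encodable list"
  assumes "computable f"
  shows "computable (\<lambda>x. if f x = [] then (undefined, []) else (hd (f x), tl (f x)))"
proof -
  have "computable (\<lambda>x. if f x = [] then enc (undefined :: 'b, [] :: 'b list) else enc (f x) - 1)"
    by (intro computable_intros assms)
  then show ?thesis
    by (rule computable_cast) (simp add: enc_uncons)
qed

lemma computable_hd [computable_intros]:
  assumes "computable f" shows "computable (\<lambda>x. hd (f x))"
proof -
  have "computable (\<lambda>x. if f x = [] then hd [] else
      fst (if f x = [] then (undefined, []) else (hd (f x), tl (f x))))"
    by (intro computable_intros assms computable_uncons)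
  then show ?thesis by (rule computable_cast) simp
qed

lemma computable_tl [computable_intros]:
  assumes "computable f" shows "computable (\<lambda>x. tl (f x))"
proof -
  have "computable (\<lambda>x. snd (if f x = [] then (undefined, []) else (hd (f x), tl (f x))))"
    by (intro computable_intros assms computable_uncons)
  then show ?thesis by (rule computable_cast) simp
qed

text \<open>The code bounds the number of iterations needed to exhaust a list before its length is
  known.\<close>

lemma length_le_enc: "length xs \<le> enc xs"
  by (induction xs) (auto simp: enc_Cons enc_prod_def intro: order_trans[OF _ le_prod_encode_2])

text \<open>The step is stationary on the empty list, so surplus iterations change nothing.\<close>

lemma length_funpow:
  "length xs \<le> k \<Longrightarrow>
    ((\<lambda>s. if fst s = [] then s else (tl (fst s), Suc (snd s))) ^^ k) (xs, n) = ([], n + length xs)"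
proof (induction k arbitrary: xs n)
  case (Suc k)
  then show ?case
    by (cases xs) (auto simp: funpow_Suc_right simp del: funpow.simps)
qed simp

lemma computable_length [computable_intros]:
  fixes f :: "'a :: encodable \<Rightarrow> 'b :: encodable list"
  assumes "computable f" shows "computable (\<lambda>x. length (f x))"
proof -
  have "computable (\<lambda>x. snd (((\<lambda>s :: 'b list \<times> nat. if fst s = [] then s else (tl (fst s), Suc (snd s)))
      ^^ enc (f x)) (f x, 0)))"
    by (intro computable_intros assms)
  then show ?thesis by (simp add: length_funpow length_le_enc)
qed

lemma funpow_tl: "(tl ^^ n) xs = drop n xs"
  by (induction n arbitrary: xs) (simp_all add: drop_Suc tl_drop)

lemma computable_nth_default [computable_intros]:
  assumes "computable f" and "computable n"
  shows "computable (\<lambda>x. nth_default c (f x) (n x))"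
proof -
  have "computable (\<lambda>x. if n x < length (f x) then hd (((\<lambda>s. tl s) ^^ n x) (f x)) else c)"
    by (intro computable_intros assms)
  then show ?thesis
    by (rule computable_cast) (simp add: nth_default_def funpow_tl hd_drop_conv_nth)
qed

text \<open>The index counts down from \<open>n\<close>, so that each new value can be consed to the
  front.\<close>

lemma map_upt_funpow:
  "k \<le> n \<Longrightarrow> ((\<lambda>s. (fst s - 1, f (fst s - 1) # snd s)) ^^ k) (n, []) = (n - k, map f [n - k..<n])"
proof (induction k)
  case (Suc k)
  then have "[n - Suc k..<n] = (n - Suc k) # [n - k..<n]"
    by (simp add: upt_rec[of "n - Suc k"] Suc_diff_Suc)
  then show ?case using Suc by simp
qed simp

lemma computable_map_upt [computable_intros]:
  fixes h :: "'a :: encodable \<Rightarrow> nat \<Rightarrow> 'b :: encodable"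
  assumes "computable (\<lambda>p. h (fst p) (snd p))" and "computable n"
  shows "computable (\<lambda>x. map (h x) [0..<n x])"
proof -
  \<comment> \<open>Extracts from the input and the loop state the pair of input and current index,
    to which the hypothesis on \<open>h\<close> applies.\<close>
  have step: "computable (\<lambda>p :: 'a \<times> nat \<times> 'b list. (fst p, fst (snd p) - 1))"
    by (intro computable_intros)
  have "computable (\<lambda>p :: 'a \<times> nat \<times> 'b list. h (fst p) (fst (snd p) - 1))"
    using computable_compose[OF assms(1) step] by simp
  then have "computable (\<lambda>x. snd (((\<lambda>s. (fst s - 1, h x (fst s - 1) # snd s)) ^^ n x) (n x, [])))"
    by (intro computable_intros assms)
  then show ?thesis unfolding map_upt_funpow[OF order_refl] by simp
qed

lemma sum_funpow:
  "((\<lambda>s. (Suc (fst s), snd s + f (fst s))) ^^ n) (0, 0) = (n, \<Sum>i<n. f i :: int)"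
  by (induction n) auto

lemma computable_sum [computable_intros]:
  fixes h :: "'a :: encodable \<Rightarrow> nat \<Rightarrow> int"
  assumes "computable (\<lambda>p. h (fst p) (snd p))" and "computable n"
  shows "computable (\<lambda>x. \<Sum>i<n x. h x i)"
proof -
  have step: "computable (\<lambda>p :: 'a \<times> nat \<times> int. (fst p, fst (snd p)))"
    by (intro computable_intros)
  have "computable (\<lambda>p :: 'a \<times> nat \<times> int. h (fst p) (fst (snd p)))"
    using computable_compose[OF assms(1) step] by simp
  then have "computable (\<lambda>x. snd (((\<lambda>s. (Suc (fst s), snd s + h x (fst s))) ^^ n x) (0, 0)))"
    by (intro computable_intros assms)
  then show ?thesis by (simp add: sum_funpow)
qed


subsection \<open>Unbounded search\<close>

text \<open>First in the order of codes. The choice depends on the predicate alone, which is what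
  later yields equivariance.\<close>

definition first_such :: "('b :: encodable \<Rightarrow> bool) \<Rightarrow> 'b" where
  "first_such P = dec (LEAST k. P (dec k))"

lemma first_such: "\<exists>c. P c \<Longrightarrow> P (first_such P)"
  unfolding first_such_def by (metis dec_enc LeastI)

lemma effective_on_first_such:
  fixes P :: "'a :: encodable \<Rightarrow> 'b :: encodable \<Rightarrow> bool"
  assumes "decidable (\<lambda>p. P (fst p) (snd p))" and "\<And>x. x \<in> A \<Longrightarrow> \<exists>c. P x c"
  shows "effective_on enc enc A (\<lambda>x. first_such (P x))"
proof -
  \<comment> \<open>The test is inverted, as \<open>Mu\<close> stops at the value 0.\<close>
  have "computable (\<lambda>p. if P (fst p) (snd p) then 0 else 1 :: nat)"
    by (intro computable_intros assms)
  then obtain p where p: "\<And>x. rec_eval p [enc x] (enc (if P (fst x) (snd x) then 0 else 1 :: nat))"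
    by (rule computableE) (rule that)
  \<comment> \<open>\<open>Mu\<close> puts the candidate in front of the input; the projections swap
    them back.\<close>
  have "rec_eval (Mu (Comp p [Comp pair_prog [Proj 1, Proj 0]])) [enc x] (enc (first_such (P x)))"
    if "x \<in> A" for x
  proof (rule rec_eval.Mu)
    let ?q = "Comp p [Comp pair_prog [Proj 1, Proj 0]]"
    have step: "rec_eval ?q [k, enc x] (if P x (dec k) then 0 else 1)" for k
    proof (rule rec_eval_Comp1)
      show "rec_eval (Comp pair_prog [Proj 1, Proj 0]) [k, enc x] (enc (x, dec k :: 'b))"
        unfolding enc_prod_def fst_conv snd_conv enc_dec by (rule rec_eval_intros)+
      show "rec_eval p [enc (x, dec k :: 'b)] (if P x (dec k) then 0 else 1)"
        using p[of "(x, dec k)"] by simp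
    qed
    show "rec_eval ?q [enc (first_such (P x)), enc x] 0"
      using step[of "enc (first_such (P x))"] first_such[OF assms(2)[OF that]] by simp
    show "\<forall>i<enc (first_such (P x)). \<exists>y. rec_eval ?q [i, enc x] (Suc y)"
    proof (intro allI impI exI)
      fix i assume "i < enc (first_such (P x))"
      then have "\<not> P x (dec i)" unfolding first_such_def enc_dec by (rule not_less_Least)
      then show "rec_eval ?q [i, enc x] (Suc 0)" using step[of i] by simp
    qed
  qed
  then show ?thesis unfolding effective_on_def by blast
qed

text \<open>Hands the result of the search, together with the original input, to a total computable
  function.\<close>

lemma effective_on_Pair_compose:
  assumes "computable g" and "effective_on enc enc A f"
  shows "effective_on enc enc A (\<lambda>x. g (x, f x))"
proof -
  obtain p where p: "\<And>x. rec_eval p [enc x] (enc (g x))"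
    using assms by (auto elim!: computableE)
  obtain q where q: "\<And>x. x \<in> A \<Longrightarrow> rec_eval q [enc x] (enc (f x))"
    using assms by (auto simp: effective_on_def)
  have "rec_eval (Comp p [Comp pair_prog [Proj 0, q]]) [enc x] (enc (g (x, f x)))" if "x \<in> A" for x
    by (rule rec_eval_Comp1[OF _ p], unfold enc_prod_def fst_conv snd_conv)
      (rule rec_eval_intros q that)+
  then show ?thesis unfolding effective_on_def by blast
qed


section \<open>Symplectic matrices\<close>

text \<open>A one-sided inverse of a square matrix over the rationals is two-sided, and the
  embedding of integral matrices is injective.\<close>

lemma int_mat_left_right_inverse:
  fixes A B :: "int mat"
  assumes A: "A \<in> carrier_mat n n" and B: "B \<in> carrier_mat n n" and AB: "A * B = 1\<^sub>m n"
  shows "B * A = 1\<^sub>m n"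
proof -
  let ?h = "map_mat rat_of_int"
  have "?h A * ?h B = 1\<^sub>m n"
    using arg_cong[OF AB, of ?h] by (simp add: of_int_hom.mat_hom_mult[OF A B] of_int_hom.mat_hom_one)
  then have "?h B * ?h A = 1\<^sub>m n"
    by (rule mat_mult_left_right_inverse[rotated 2]) (use A B in auto)
  then have "?h (B * A) = ?h (1\<^sub>m n)"
    by (simp add: of_int_hom.mat_hom_mult[OF B A] of_int_hom.mat_hom_one)
  then show ?thesis by (rule of_int_hom.mat_hom_inj)
qed

lemma J_mat_carrier [simp]: "J_mat n \<in> carrier_mat (2 * n) (2 * n)"
  unfolding J_mat_def mult_2 by (rule four_block_carrier_mat) auto

lemma J_mat_index:
  assumes "i < 2 * n" and "j < 2 * n"
  shows "J_mat n $$ (i, j) = (if j = n + i then 1 else if i = n + j then -1 else 0)"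
  using assms by (auto simp: J_mat_def)

lemma J_mat_mult_transpose: "J_mat n * transpose_mat (J_mat n) = 1\<^sub>m (2 * n)"
proof -
  have [simp]: "- 0\<^sub>m n n = (0\<^sub>m n n :: int mat)" by (rule eq_matI) auto
  have "J_mat n * transpose_mat (J_mat n) = four_block_mat (1\<^sub>m n) (0\<^sub>m n n) (0\<^sub>m n n) (1\<^sub>m n)"
    unfolding J_mat_def
    by (subst transpose_four_block_mat[of _ n n _ n _ n], simp_all,
        subst mult_four_block_mat[of _ n n _ n _ n _ _ n _ n], simp_all add: transpose_uminus)
  then show ?thesis by (simp add: mult_2)
qed

text \<open>Each row of \<open>J_mat n\<close> has one nonzero entry: the matrix swaps the halves of
  \<open>y\<close> and negates one of them. The resulting sum is the formula that
  \<open>gram\<close> evaluates.\<close>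

lemma omega_eq_sum:
  assumes x: "x \<in> carrier_vec (2 * n)" and y: "y \<in> carrier_vec (2 * n)"
  shows "omega n x y = (\<Sum>k<n. x $ k * y $ (n + k) - x $ (n + k) * y $ k)"
proof -
  have Jy: "(J_mat n *\<^sub>v y) $ i = (if i < n then y $ (n + i) else - y $ (i - n))" if "i < 2 * n" for i
  proof -
    have "(J_mat n *\<^sub>v y) $ i = (\<Sum>j = 0..<2 * n. J_mat n $$ (i, j) * y $ j)"
      using that y carrier_matD[OF J_mat_carrier[of n]] by (simp add: scalar_prod_def)
    also have "\<dots> = (\<Sum>j = 0..<2 * n. if j = (if i < n then n + i else i - n)
        then (if i < n then 1 else -1) * y $ j else 0)"
      using that by (intro sum.cong) (auto simp: J_mat_index)
    finally show ?thesis using that by auto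
  qed
  have "omega n x y = (\<Sum>i = 0..<n + n. x $ i * (if i < n then y $ (n + i) else - y $ (i - n)))"
    unfolding omega_def scalar_prod_def
    using y carrier_matD[OF J_mat_carrier[of n]] by (auto intro!: sum.cong simp: Jy simp del: index_mult_mat_vec)
  also have "\<dots> = (\<Sum>i = 0..<n. x $ i * y $ (n + i)) + (\<Sum>i = n..<n + n. x $ i * - y $ (i - n))"
    by (subst sum.atLeastLessThan_concat[of 0 n "n + n", symmetric]) auto
  also have "(\<Sum>i = n..<n + n. x $ i * - y $ (i - n)) = (\<Sum>i = 0..<n. x $ (n + i) * - y $ i)"
    using sum.shift_bounds_nat_ivl[of "\<lambda>i. x $ i * - y $ (i - n)" 0 n n] by (simp add: add.commute)
  finally show ?thesis
    by (simp add: lessThan_atLeast0 sum_subtractf sum_negf)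
qed

lemma mult_J_mat_transpose_index:
  assumes W: "W \<in> carrier_mat m (2 * n)" and i: "i < m" and j: "j < m"
  shows "(W * J_mat n * transpose_mat W) $$ (i, j) = omega n (row W i) (row W j)"
proof -
  have "W * J_mat n * transpose_mat W = W * (J_mat n * transpose_mat W)"
    by (rule assoc_mult_mat[OF W J_mat_carrier]) (use W in simp)
  moreover have "col (J_mat n * transpose_mat W) j = J_mat n *\<^sub>v row W j"
    using W j by (subst col_mult2[of _ "2 * n" "2 * n" _ m]) auto
  ultimately show ?thesis
    using assms carrier_matD[OF J_mat_carrier[of n]] by (simp add: omega_def)
qed

lemma mult_J_mat_transpose_eq_iff:
  assumes W: "W \<in> carrier_mat (2 * n) (2 * n)"
  shows "W * J_mat n * transpose_mat W = J_mat n \<longleftrightarrow>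
    (\<forall>i<2 * n. \<forall>j<2 * n. omega n (row W i) (row W j) = J_mat n $$ (i, j))"
  using W carrier_matD[OF J_mat_carrier[of n]]
  by (auto simp: mat_eq_iff mult_J_mat_transpose_index[OF W] simp del: index_mult_mat(1))

text \<open>Since \<open>W J W^T J^T = J J^T = 1\<close>, the integral matrix
  \<open>J W^T J^T\<close> is a right inverse of \<open>W\<close>, hence a two-sided one.\<close>

lemma J_mat_preserving_invertible:
  assumes W: "W \<in> carrier_mat (2 * n) (2 * n)" and eq: "W * J_mat n * transpose_mat W = J_mat n"
  obtains U where "U \<in> carrier_mat (2 * n) (2 * n)" and "W * U = 1\<^sub>m (2 * n)" and "U * W = 1\<^sub>m (2 * n)"
proof -
  let ?J = "J_mat n" and ?WT = "transpose_mat W" and ?JT = "transpose_mat (J_mat n)" and ?d = "2 * n"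
  have c: "?J \<in> carrier_mat ?d ?d" "?WT \<in> carrier_mat ?d ?d" "?JT \<in> carrier_mat ?d ?d"
    using W by auto
  have "W * (?J * ?WT * ?JT) = W * ?J * ?WT * ?JT"
    using W c by (simp add: assoc_mult_mat[of _ ?d ?d _ ?d _ ?d]
      mult_carrier_mat[of _ ?d ?d _ ?d])
  also have "\<dots> = 1\<^sub>m ?d" by (simp add: eq J_mat_mult_transpose)
  finally have "W * (?J * ?WT * ?JT) = 1\<^sub>m ?d" .
  moreover have "?J * ?WT * ?JT \<in> carrier_mat ?d ?d"
    by (rule mult_carrier_mat[OF mult_carrier_mat[OF c(1,2)] c(3)])
  ultimately show ?thesis using that int_mat_left_right_inverse[OF W] by blast
qed

text \<open>\<open>Sp n\<close> is closed under transposition, which the row-vector convention requires.\<close>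

lemma Sp_mult_J_mat_transpose:
  assumes "P \<in> Sp n"
  shows "P * J_mat n * transpose_mat P = J_mat n"
proof -
  let ?J = "J_mat n" and ?PT = "transpose_mat P" and ?JT = "transpose_mat (J_mat n)" and ?d = "2 * n"
  have c: "P \<in> carrier_mat ?d ?d" "?J \<in> carrier_mat ?d ?d" "?PT \<in> carrier_mat ?d ?d"
      "?JT \<in> carrier_mat ?d ?d" and eq: "?PT * ?J * P = ?J"
    using assms by (auto simp: Sp_def)
  note assoc = assoc_mult_mat[of _ ?d ?d _ ?d _ ?d] mult_carrier_mat[of _ ?d ?d _ ?d]
  have JTJ: "?JT * ?J = 1\<^sub>m ?d"
    by (rule int_mat_left_right_inverse[OF c(2,4) J_mat_mult_transpose])
  \<comment> \<open>\<open>J^T P^T J\<close> is a left inverse of \<open>P\<close>, hence a right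
    one: \<open>P J^T P^T J = 1\<close>. Multiplying by \<open>J^T\<close> on the right leaves
    \<open>P J^T P^T = J^T\<close>, whose transpose is the claim.\<close>
  have "?JT * ?PT * ?J * P = ?JT * (?PT * ?J * P)" using c by (simp add: assoc)
  then have "?JT * ?PT * ?J * P = 1\<^sub>m ?d" by (simp add: eq JTJ)
  then have "P * (?JT * ?PT * ?J) = 1\<^sub>m ?d"
    by (rule int_mat_left_right_inverse[rotated 2]) (simp_all add: c assoc)
  then have "P * (?JT * ?PT * ?J) * ?JT = ?JT"
    by (simp only: left_mult_one_mat[OF c(4)])
  moreover have "P * (?JT * ?PT * ?J) * ?JT = P * ?JT * ?PT * (?J * ?JT)" using c by (simp add: assoc)
  ultimately have "P * ?JT * ?PT = ?JT"
    using right_mult_one_mat[of "P * ?JT * ?PT" ?d ?d] c by (simp add: J_mat_mult_transpose assoc)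
  then have "transpose_mat (P * (?JT * ?PT)) = ?J" using c by (simp add: assoc)
  then show ?thesis
    using c assoc_mult_mat[OF c(1,2,3)] by (simp add: transpose_mult[of _ ?d ?d _ ?d])
qed

section \<open>Generation and bases of the lattice in matrix form\<close>

lemma generates_imp_combination:
  assumes gen: "generates d V" and x: "x \<in> carrier_vec d"
  shows "\<exists>c. mat_of_cols d V *\<^sub>v vec (length V) c = x"
proof -
  interpret idom_vec d "TYPE(int)" .
  have V: "set V \<subseteq> carrier_vec d" using gen by (simp add: generates_def)
  have "x \<in> span (set V)" using gen x by (simp add: generates_def)
  \<comment> \<open>List combinations attach coefficients to positions, so repeated vectors in the
    tuple do no harm.\<close>
  then have "x \<in> span_list V" by (simp add: span_list_as_span[OF V])
  then obtain c where "x = lincomb_list c V" by (auto simp: span_list_def)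
  moreover have "\<forall>v \<in> set V. dim_vec v = d" using V by auto
  ultimately show ?thesis using lincomb_list_as_mat_mult by metis
qed

text \<open>The rows span because \<open>x = W^T (U^T x)\<close>. They are distinct because column
  \<open>i\<close> of \<open>U\<close> pairs to 1 with row \<open>i\<close> of \<open>W\<close> and
  to 0 with every other row. They are independent because \<open>det W * det U = 1\<close>.\<close>

lemma Z_basis_rows:
  assumes W: "W \<in> carrier_mat d d" and U: "U \<in> carrier_mat d d"
    and WU: "W * U = 1\<^sub>m d" and UW: "U * W = 1\<^sub>m d"
  shows "Z_basis d (rows W)"
proof -
  interpret idom_vec d "TYPE(int)" .
  have rows: "set (rows W) \<subseteq> carrier_vec d" and len: "length (rows W) = d"
    using W by (auto simp: rows_def)
  then have dims: "\<forall>w \<in> set (rows W). dim_vec w = d" by auto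
  have cols: "mat_of_cols d (rows W) = transpose_mat W"
    using W by (auto simp: mat_of_cols_def)
  have "x \<in> span (set (rows W))" if x: "x \<in> carrier_vec d" for x
  proof -
    have "transpose_mat W *\<^sub>v (transpose_mat U *\<^sub>v x) = transpose_mat (U * W) *\<^sub>v x"
      using W U x by (simp add: transpose_mult[OF U W] assoc_mult_mat_vec[of _ d d _ d])
    also have "\<dots> = x" using x by (simp add: UW)
    finally have "x = transpose_mat W *\<^sub>v (transpose_mat U *\<^sub>v x)" ..
    also have "transpose_mat U *\<^sub>v x = vec (length (rows W)) (\<lambda>i. (transpose_mat U *\<^sub>v x) $ i)"
      using len U by (intro eq_vecI) auto
    finally have "x = lincomb_list (\<lambda>i. (transpose_mat U *\<^sub>v x) $ i) (rows W)"
      unfolding lincomb_list_as_mat_mult[OF dims] cols .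
    then have "x \<in> span_list (rows W)" by (auto simp: span_list_def)
    then show ?thesis by (simp add: span_list_as_span[OF rows])
  qed
  then have "generates d (rows W)"
    using rows span_is_subset2[OF rows] by (auto simp: generates_def)
  moreover have "distinct (rows W)"
  proof (unfold distinct_conv_nth len, intro allI impI)
    fix i j assume ij: "i < d" "j < d" "i \<noteq> j"
    have "(W * U) $$ (i, i) = row W i \<bullet> col U i" "(W * U) $$ (j, i) = row W j \<bullet> col U i"
      using ij W U by auto
    then show "rows W ! i \<noteq> rows W ! j" using ij W by (auto simp: WU)
  qed
  moreover have "det W \<noteq> 0" using det_mult[OF W U] by (auto simp: WU)
  then have "lin_indpt (set (rows W))" by (rule det_not_0_imp_lin_indpt_rows[OF W])
  ultimately show ?thesis by (simp add: Z_basis_def)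
qed

lemma symplectic_basis_rows:
  assumes W: "W \<in> carrier_mat (2 * n) (2 * n)" and eq: "W * J_mat n * transpose_mat W = J_mat n"
  shows "symplectic_basis n (rows W)"
proof -
  have "Z_basis (2 * n) (rows W)"
    using J_mat_preserving_invertible[OF W eq] Z_basis_rows[OF W] by metis
  moreover have "omega n (rows W ! i) (rows W ! j) = J_mat n $$ (i, j)" if "i < 2 * n" "j < 2 * n" for i j
    using eq that W by (simp add: mult_J_mat_transpose_eq_iff[OF W])
  ultimately show ?thesis
    using W by (auto simp: symplectic_basis_def J_mat_index)
qed


section \<open>The search\<close>

text \<open>The defaults let any list of lists, however ragged, act as a matrix of any size, so the
  search needs no check on the shape of its candidates.\<close>

definition entry :: "int list list \<Rightarrow> nat \<Rightarrow> nat \<Rightarrow> int" where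
  "entry A i j = nth_default 0 (nth_default [] A i) j"

text \<open>The rank is recovered from the tuple, the only input, so one program serves all
  \<open>n\<close>. The value 0 for the empty tuple is right, since that tuple generates only the
  zero lattice.\<close>

definition dimension :: "int list list \<Rightarrow> nat" where
  "dimension V = (if V = [] then 0 else length (hd V))"

definition combination :: "int list list \<Rightarrow> int list list \<Rightarrow> int list list" where
  "combination C V =
    map (\<lambda>i. map (\<lambda>j. \<Sum>k<length V. entry C i k * entry V k j) [0..<dimension V]) [0..<dimension V]"

text \<open>The bounds are written \<open>n + n\<close> so that closure under addition suffices for
  computability.\<close>

definition gram :: "nat \<Rightarrow> int list list \<Rightarrow> int list list" where
  "gram n W = map (\<lambda>i. map (\<lambda>j.
    \<Sum>k<n. entry W i k * entry W j (n + k) - entry W i (n + k) * entry W j k) [0..<n + n]) [0..<n + n]"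

definition standard_gram :: "nat \<Rightarrow> int list list" where
  "standard_gram n = map (\<lambda>i. map (\<lambda>j.
    if j = n + i then 1 else if i = n + j then -1 else 0) [0..<n + n]) [0..<n + n]"

definition symplectic_coeffs :: "int list list \<Rightarrow> int list list \<Rightarrow> bool" where
  "symplectic_coeffs V C \<longleftrightarrow>
    gram (dimension V div 2) (combination C V) = standard_gram (dimension V div 2)"

lemma computable_combination:
  assumes "computable C" and "computable V"
  shows "computable (\<lambda>x. combination (C x) (V x))"
  unfolding combination_def entry_def dimension_def
  \<comment> \<open>The composition rules cover \<open>C\<close> and \<open>V\<close> below bound
    indices, where their argument is a component of a pair.\<close>
  by (intro computable_intros assms computable_compose[OF assms(1)] computable_compose[OF assms(2)])

lemma computable_gram:
  assumes "computable n" and "computable W"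
  shows "computable (\<lambda>x. gram (n x) (W x))"
  unfolding gram_def entry_def
  by (intro computable_intros assms computable_compose[OF assms(1)] computable_compose[OF assms(2)])

lemma computable_standard_gram:
  assumes "computable n"
  shows "computable (\<lambda>x. standard_gram (n x))"
  unfolding standard_gram_def
  by (intro computable_intros assms computable_compose[OF assms(1)])

lemma decidable_symplectic_coeffs: "decidable (\<lambda>p. symplectic_coeffs (fst p) (snd p))"
  unfolding symplectic_coeffs_def dimension_def
  by (intro computable_intros computable_combination computable_gram computable_standard_gram)

section \<open>List computations as matrix identities\<close>

definition coeff_mat :: "nat \<Rightarrow> nat \<Rightarrow> int list list \<Rightarrow> int mat" where
  "coeff_mat d m C = mat d m (\<lambda>(i, k). entry C i k)"

lemma coeff_mat_carrier [simp]: "coeff_mat d m C \<in> carrier_mat d m"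
  by (simp add: coeff_mat_def)

lemma coeff_mat_mult_carrier [simp]:
  "coeff_mat d (length V) C * mat_of_rows d V \<in> carrier_mat d d"
  by (rule mult_carrier_mat[OF coeff_mat_carrier mat_of_rows_carrier(1)])

abbreviation vecs_to_lists :: "int vec list \<Rightarrow> int list list" where
  "vecs_to_lists \<equiv> map list_of_vec"

lemma entry_vecs_to_lists:
  "k < length V \<Longrightarrow> j < dim_vec (V ! k) \<Longrightarrow> entry (vecs_to_lists V) k j = V ! k $ j"
  by (simp add: entry_def nth_default_def list_of_vec_index)

lemma dimension_vecs_to_lists:
  "set V \<subseteq> carrier_vec d \<Longrightarrow> V = [] \<longrightarrow> d = 0 \<Longrightarrow> dimension (vecs_to_lists V) = d"
  by (cases V) (auto simp: dimension_def)

lemma vecs_to_lists_rows: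
  assumes "M \<in> carrier_mat m d"
  shows "vecs_to_lists (rows M) = map (\<lambda>i. map (\<lambda>j. M $$ (i, j)) [0..<d]) [0..<m]"
  using assms by (auto simp: rows_def list_of_vec_map)

lemma combination_vecs_to_lists:
  assumes V: "set V \<subseteq> carrier_vec d" and "V = [] \<longrightarrow> d = 0"
  shows "combination C (vecs_to_lists V) =
    vecs_to_lists (rows (coeff_mat d (length V) C * mat_of_rows d V))"
proof -
  have dim: "V ! k \<in> carrier_vec d" if "k < length V" for k
    using V that by (meson nth_mem subsetD)
  let ?M = "coeff_mat d (length V) C * mat_of_rows d V"
  have "?M $$ (i, j) = (\<Sum>k<length V. entry C i k * entry (vecs_to_lists V) k j)"
    if "i < d" "j < d" for i j
  proof -
    have "?M $$ (i, j) = (\<Sum>k = 0..<length V. entry C i k * V ! k $ j)"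
      using that by (simp add: scalar_prod_def coeff_mat_def mat_of_rows_index)
    also have "\<dots> = (\<Sum>k<length V. entry C i k * entry (vecs_to_lists V) k j)"
      unfolding lessThan_atLeast0 using that carrier_vecD[OF dim]
      by (intro sum.cong) (simp_all add: entry_vecs_to_lists)
    finally show ?thesis .
  qed
  then show ?thesis
    unfolding vecs_to_lists_rows[OF coeff_mat_mult_carrier]
    by (simp add: combination_def dimension_vecs_to_lists[OF assms] del: index_mult_mat)
qed

text \<open>The bridge between the executable test and matrices: correctness and equivariance are
  both argued on the right-hand side.\<close>

lemma symplectic_coeffs_iff:
  assumes V: "set V \<subseteq> carrier_vec (2 * n)" and "V = [] \<longrightarrow> 2 * n = 0"
  defines "W C \<equiv> coeff_mat (2 * n) (length V) C * mat_of_rows (2 * n) V"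
  shows "symplectic_coeffs (vecs_to_lists V) C \<longleftrightarrow> W C * J_mat n * transpose_mat (W C) = J_mat n"
proof -
  have W: "W C \<in> carrier_mat (2 * n) (2 * n)" unfolding W_def by simp
  have "omega n (row (W C) i) (row (W C) j) =
      (\<Sum>k<n. entry (vecs_to_lists (rows (W C))) i k * entry (vecs_to_lists (rows (W C))) j (n + k)
        - entry (vecs_to_lists (rows (W C))) i (n + k) * entry (vecs_to_lists (rows (W C))) j k)"
    if "i < 2 * n" "j < 2 * n" for i j
    using that W by (subst omega_eq_sum) (auto simp: entry_vecs_to_lists intro!: sum.cong)
  then show ?thesis
    unfolding symplectic_coeffs_def dimension_vecs_to_lists[OF assms(1,2)]
      combination_vecs_to_lists[OF assms(1,2)] W_def[symmetric] mult_J_mat_transpose_eq_iff[OF W]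
    by (simp add: gram_def standard_gram_def list_eq_iff_nth_eq J_mat_index mult_2)
qed

text \<open>In positive dimension the first unit vector would be an empty sum. This supplies the
  side condition on \<open>V = []\<close> in the lemmas about lists.\<close>

lemma generates_Nil: "generates d [] \<Longrightarrow> d = 0"
proof (rule ccontr)
  assume gen: "generates d []" and d: "d \<noteq> 0"
  obtain c where "mat_of_cols d [] *\<^sub>v vec 0 c = (unit_vec d 0 :: int vec)"
    using generates_imp_combination[OF gen unit_vec_carrier[of d 0]] by auto
  then have "(mat_of_cols d [] *\<^sub>v vec 0 c) $ 0 = (unit_vec d 0 :: int vec) $ 0" by simp
  with d show False by (simp add: scalar_prod_def)
qed

lemma symplectic_coeffs_exist:
  assumes gen: "generates (2 * n) V"
  shows "\<exists>C. symplectic_coeffs (vecs_to_lists V) C"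
proof -
  let ?d = "2 * n" and ?m = "length V"
  have V: "set V \<subseteq> carrier_vec ?d" and nil: "V = [] \<longrightarrow> ?d = 0"
    using gen generates_Nil[of ?d] by (auto simp: generates_def)
  have "\<exists>c. mat_of_cols ?d V *\<^sub>v vec ?m c = unit_vec ?d i" for i
    by (rule generates_imp_combination[OF gen unit_vec_carrier])
  then obtain c where c: "\<And>i. mat_of_cols ?d V *\<^sub>v vec ?m (c i) = unit_vec ?d i" by metis
  \<comment> \<open>Row \<open>i\<close> holds coefficients expressing the unit vector
    \<open>i\<close> through \<open>V\<close>, so the product with \<open>V\<close> is the identity,
    which satisfies \<open>1 J 1^T = J\<close>.\<close>
  define C where "C = map (\<lambda>i. map (c i) [0..<?m]) [0..<?d]"
  have "coeff_mat ?d ?m C * mat_of_rows ?d V = 1\<^sub>m ?d"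
  proof (rule eq_matI)
    fix i j assume "i < dim_row (1\<^sub>m ?d)" "j < dim_col (1\<^sub>m ?d)"
    then have ij: "i < ?d" "j < ?d" by auto
    have "(coeff_mat ?d ?m C * mat_of_rows ?d V) $$ (i, j) = (mat_of_cols ?d V *\<^sub>v vec ?m (c i)) $ j"
      using ij by (auto simp: scalar_prod_def coeff_mat_def mat_of_rows_index mat_of_cols_index entry_def
          nth_default_def C_def mult.commute intro!: sum.cong)
    then show "(coeff_mat ?d ?m C * mat_of_rows ?d V) $$ (i, j) = 1\<^sub>m ?d $$ (i, j)"
      using ij by (simp add: c)
  qed (simp_all add: coeff_mat_def)
  then have "symplectic_coeffs (vecs_to_lists V) C"
    unfolding symplectic_coeffs_iff[OF V nil]
    by (simp add: left_mult_one_mat[OF J_mat_carrier] right_mult_one_mat[OF J_mat_carrier])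
  then show ?thesis ..
qed


section \<open>Equivariance\<close>

lemma rows_mult_eq_tuple_mult_mat:
  assumes "W \<in> carrier_mat m d" and "P \<in> carrier_mat d d"
  shows "rows (W * P) = tuple_mult_mat (rows W) P"
  using assms by (auto simp: list_eq_iff_nth_eq tuple_mult_mat_def row_mult_mat_def
      intro!: eq_vecI comm_scalar_prod[of _ d])

lemma mat_of_rows_tuple_mult_mat:
  assumes "set V \<subseteq> carrier_vec d" and "P \<in> carrier_mat d d"
  shows "mat_of_rows d (tuple_mult_mat V P) = mat_of_rows d V * P"
proof -
  have "V ! k \<in> carrier_vec d" if "k < length V" for k
    using assms that by (meson nth_mem subsetD)
  then show ?thesis
    using assms by (intro eq_matI) (auto simp: mat_of_rows_index tuple_mult_mat_def row_mult_mat_def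
      intro!: comm_scalar_prod[of _ d])
qed

section \<open>The procedure and its properties\<close>

definition symp_coeffs :: "int vec list \<Rightarrow> int list list" where
  "symp_coeffs V = first_such (symplectic_coeffs (vecs_to_lists V))"

definition symp_basis :: "int vec list \<Rightarrow> int vec list" where
  "symp_basis V = map vec_of_list (combination (symp_coeffs V) (vecs_to_lists V))"

lemma symp_basis_eq_rows:
  assumes "set V \<subseteq> carrier_vec d" and "V = [] \<longrightarrow> d = 0"
  shows "symp_basis V = rows (coeff_mat d (length V) (symp_coeffs V) * mat_of_rows d V)"
  unfolding symp_basis_def combination_vecs_to_lists[OF assms] by (simp add: comp_def vec_list)

lemma effective_on_symp_basis:
  "effective_on encode_tuple encode_tuple {V. \<exists>n. generates (2 * n) V} symp_basis"
proof -
  let ?A = "vecs_to_lists ` {V. \<exists>n. generates (2 * n) V}"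
  \<comment> \<open>The numbering of tuples is the class numbering of their lists of entries, so
    programs for lists of lists serve unchanged for vectors.\<close>
  have encode: "encode_tuple V = enc (vecs_to_lists V)" for V
    by (simp add: encode_tuple_def enc_list_def comp_def)
  have "effective_on enc enc ?A (\<lambda>V. first_such (symplectic_coeffs V))"
    by (rule effective_on_first_such[OF decidable_symplectic_coeffs]) (auto intro: symplectic_coeffs_exist)
  moreover have "computable (\<lambda>p. combination (snd p) (fst p))"
    by (intro computable_combination computable_intros)
  ultimately have "effective_on enc enc ?A (\<lambda>V. combination (first_such (symplectic_coeffs V)) V)"
    using effective_on_Pair_compose by fastforce
  then show ?thesis
    by (simp add: effective_on_def encode symp_basis_def symp_coeffs_def comp_def list_vec)
qed

lemma symplectic_basis_symp_basis:
  assumes gen: "generates (2 * n) V"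
  shows "symplectic_basis n (symp_basis V)"
proof -
  have V: "set V \<subseteq> carrier_vec (2 * n)" and nil: "V = [] \<longrightarrow> 2 * n = 0"
    using gen generates_Nil[of "2 * n"] by (auto simp: generates_def)
  have "symplectic_coeffs (vecs_to_lists V) (symp_coeffs V)"
    unfolding symp_coeffs_def by (rule first_such[OF symplectic_coeffs_exist[OF gen]])
  then show ?thesis
    unfolding symp_basis_eq_rows[OF V nil] symplectic_coeffs_iff[OF V nil]
    by (intro symplectic_basis_rows) auto
qed

lemma symp_basis_tuple_mult_mat:
  assumes gen: "generates (2 * n) V" and P: "P \<in> Sp n"
  shows "symp_basis (tuple_mult_mat V P) = tuple_mult_mat (symp_basis V) P"
proof -
  let ?d = "2 * n" and ?VP = "tuple_mult_mat V P"
  have V: "set V \<subseteq> carrier_vec ?d" and nil: "V = [] \<longrightarrow> ?d = 0"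
    using gen generates_Nil[of ?d] by (auto simp: generates_def)
  have Pc: "P \<in> carrier_mat ?d ?d" using P by (simp add: Sp_def)
  have VP: "set ?VP \<subseteq> carrier_vec ?d" and nilP: "?VP = [] \<longrightarrow> ?d = 0" and len: "length ?VP = length V"
    using V nil Pc by (auto simp: tuple_mult_mat_def row_mult_mat_def)
  let ?W = "\<lambda>C. coeff_mat ?d (length V) C * mat_of_rows ?d V"
  have W: "?W C \<in> carrier_mat ?d ?d" for C by simp
  have WP: "coeff_mat ?d (length ?VP) C * mat_of_rows ?d ?VP = ?W C * P" for C
    unfolding mat_of_rows_tuple_mult_mat[OF V Pc] len
    by (rule assoc_mult_mat[symmetric, of _ ?d "length V" _ ?d _ ?d]) (use Pc in auto)
  \<comment> \<open>The product contains \<open>P J P^T\<close>, which collapses to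
    \<open>J\<close>: both tuples give the same Gram matrix for every \<open>C\<close>.\<close>
  have "?W C * P * J_mat n * transpose_mat (?W C * P) = ?W C * J_mat n * transpose_mat (?W C)" for C
  proof -
    have "?W C * P * J_mat n * transpose_mat (?W C * P)
        = ?W C * (P * J_mat n * transpose_mat P) * transpose_mat (?W C)"
      using Pc W[of C] by (simp add: transpose_mult[OF W Pc] assoc_mult_mat[of _ ?d ?d _ ?d _ ?d]
          mult_carrier_mat[of _ ?d ?d _ ?d])
    then show ?thesis by (simp add: Sp_mult_J_mat_transpose[OF P])
  qed
  \<comment> \<open>The tests agree as predicates on all candidates, so their first solutions
    coincide.\<close>
  then have "symplectic_coeffs (vecs_to_lists ?VP) = symplectic_coeffs (vecs_to_lists V)"
    by (auto simp: fun_eq_iff symplectic_coeffs_iff[OF V nil] symplectic_coeffs_iff[OF VP nilP] WP)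
  then have "symp_coeffs ?VP = symp_coeffs V" by (simp add: symp_coeffs_def)
  then show ?thesis
    unfolding symp_basis_eq_rows[OF V nil] symp_basis_eq_rows[OF VP nilP] WP
    by (simp add: rows_mult_eq_tuple_mult_mat[OF W Pc])
qed

theorem theorem5p1p1:
  shows "\<exists>SympBas :: int vec list \<Rightarrow> int vec list.
    effective_on encode_tuple encode_tuple {V. \<exists>n. generates (2 * n) V} SympBas \<and>
    (\<forall>n V. generates (2 * n) V \<longrightarrow>
      symplectic_basis n (SympBas V) \<and>
      (\<forall>P \<in> Sp n. SympBas (tuple_mult_mat V P) = tuple_mult_mat (SympBas V) P))"
  using effective_on_symp_basis symplectic_basis_symp_basis symp_basis_tuple_mult_mat by blast

end
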